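(* Let $q\ge 0$ be an integer, let $G=(V,E)$ be a tree whose vertices in $B\subseteq V$ are coloured and whose vertices in $W=V\setminus B$ are uncoloured, and let $C(G)$ be the bipartite contraction of $G$. If $C(G)$ has a matching of size $q+1$, then there is a $\mathrm{CCR}_q$ move on $G$ which permits at least one new vertex of $G$ to be forced (whatever the oracle's response).
   Context: Graphs are finite, simple and undirected. Colour change rule (CCR): in a graph some of whose vertices are coloured, if a coloured vertex has exactly one uncoloured neighbour, then that neighbour may become coloured (it is "forced"). $\mathrm{CCR}_q$ move on $G$ with coloured set $B$ ($q\ge 0$ an integer): let $W_1,\dots,W_k$ be the vertex sets of the connected components of $G[V\setminus B]$. If $k\ge q+1$, the player selects at least $q+1$ of the $W_i$'s and announces them to an oracle; the oracle returns a nonempty subset $\{W_{i_1},\dots,W_{i_\ell}\}$ of the selected components; the player may then apply the CCR in the induced subgraph $G[B\cup W_{i_1}\cup\dots\cup W_{i_\ell}]$. A $\mathrm{CCR}_q$ move (a selection of at least $q+1$ components) "permits at least one new vertex to be forced" if for every nonempty subset the oracle may return, the CCR can force at least one uncoloured vertex in the corresponding induced subgraph. Bipartite contraction $C(G)$: the graph obtained from $G$ by contracting every edge joining two coloured vertices and every edge joining two uncoloured vertices, repeatedly, until all uncoloured vertices are adjacent only to coloured vertices and vice versa. Thus the coloured (resp. uncoloured) vertices of $C(G)$ correspond to the connected components of $G[B]$ (resp. of $G[V\setminus B]$), and the edges of $C(G)$ correspond to the edges of $G$ between $B$ and $V\setminus B$. *)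

theory Defs
  imports "Graph_Theory.Digraph_Component" "HOL-Library.Disjoint_Sets"
begin

text \<open>
  A finite simple undirected graph is a \<^locale>\<open>pair_graph\<close>, i.e. a finite loop-free symmetric
  digraph whose arcs are pairs of vertices; an undirected edge is a pair of opposite arcs.
  Walking along an edge and back again is a \<^const>\<open>pre_digraph.cycle\<close> of length 2 in
  such a digraph, so \<^const>\<open>tree\<close> does not describe undirected trees: only the cycles with at
  least three arcs may be forbidden.
\<close>

definition undirected_tree :: "'a pair_pre_digraph \<Rightarrow> bool" where
  "undirected_tree G \<longleftrightarrow> pair_graph G \<and> Digraph_Component.connected (with_proj G) \<and>
     \<not> (\<exists>p. pre_digraph.cycle (with_proj G) p \<and> length p \<ge> 3)"

text \<open>
  Vertex sets of the connected components of \<open>G[S]\<close>; as \<open>G\<close> is symmetric, its strongly connected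
  components are its connected components.
\<close>

definition components :: "'a pair_pre_digraph \<Rightarrow> 'a set \<Rightarrow> 'a set set" where
  "components G S = pre_digraph.sccs_verts (with_proj G \<restriction> S)"

definition matching :: "'a pair_pre_digraph \<Rightarrow> 'a set set \<Rightarrow> bool" where
  "matching G M \<longleftrightarrow> M \<subseteq> {{u, v} | u v. (u, v) \<in> parcs G} \<and> disjoint M"


subsection \<open>Colour change rule\<close>

text \<open>In \<open>H\<close> with coloured set \<open>B\<close>, the coloured vertex \<open>b\<close> forces its only uncoloured neighbour \<open>w\<close>.\<close>

definition ccr_forces :: "('a, 'b) pre_digraph \<Rightarrow> 'a set \<Rightarrow> 'a \<Rightarrow> 'a \<Rightarrow> bool" where
  "ccr_forces H B b w \<longleftrightarrow> b \<in> verts H \<inter> B \<and> {v \<in> verts H - B. b \<rightarrow>\<^bsub>H\<^esub> v} = {w}"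

text \<open>
  A move is the set \<open>S\<close> of selected components; that there are at least \<open>q + 1\<close> components in total
  is implied. The oracle answers with an arbitrary nonempty \<open>T \<subseteq> S\<close>.
\<close>

definition ccr_move :: "nat \<Rightarrow> 'a pair_pre_digraph \<Rightarrow> 'a set \<Rightarrow> 'a set set \<Rightarrow> bool" where
  "ccr_move q G B S \<longleftrightarrow> S \<subseteq> components G (pverts G - B) \<and> card S \<ge> q + 1"

definition permits_force :: "'a pair_pre_digraph \<Rightarrow> 'a set \<Rightarrow> 'a set set \<Rightarrow> bool" where
  "permits_force G B S \<longleftrightarrow>
     (\<forall>T. T \<subseteq> S \<and> T \<noteq> {} \<longrightarrow> (\<exists>b w. ccr_forces (with_proj G \<restriction> (B \<union> \<Union>T)) B b w))"


subsection \<open>Bipartite contraction\<close>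

text \<open>
  While edges of \<open>G\<close> are being contracted, a vertex of the current graph is represented by the set
  of the vertices of \<open>G\<close> that have been merged into it. Only vertices of the same colour are ever
  merged, so a vertex \<open>X\<close> is coloured if \<open>X \<subseteq> B\<close> and uncoloured if \<open>X \<inter> B = {}\<close>. Loops are dropped
  and parallel edges identified.
\<close>

definition singleton_graph :: "'a pair_pre_digraph \<Rightarrow> 'a set pair_pre_digraph" where
  "singleton_graph G =
     \<lparr> pverts = (\<lambda>v. {v}) ` pverts G, parcs = (\<lambda>(u, v). ({u}, {v})) ` parcs G \<rparr>"

definition merge :: "'a set \<Rightarrow> 'a set \<Rightarrow> 'a set \<Rightarrow> 'a set" where
  "merge X Y Z = (if Z = X \<or> Z = Y then X \<union> Y else Z)"

definition contract_edge ::
  "'a set pair_pre_digraph \<Rightarrow> 'a set \<Rightarrow> 'a set \<Rightarrow> 'a set pair_pre_digraph" where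
  "contract_edge H X Y =
     \<lparr> pverts = merge X Y ` pverts H,
       parcs = {(merge X Y U, merge X Y V) | U V. (U, V) \<in> parcs H \<and> merge X Y U \<noteq> merge X Y V} \<rparr>"

inductive contraction_step ::
  "'a set \<Rightarrow> 'a set pair_pre_digraph \<Rightarrow> 'a set pair_pre_digraph \<Rightarrow> bool" for B where
  coloured: "(X, Y) \<in> parcs H \<Longrightarrow> X \<subseteq> B \<Longrightarrow> Y \<subseteq> B \<Longrightarrow> contraction_step B H (contract_edge H X Y)"
| uncoloured: "(X, Y) \<in> parcs H \<Longrightarrow> X \<inter> B = {} \<Longrightarrow> Y \<inter> B = {} \<Longrightarrow>
    contraction_step B H (contract_edge H X Y)"

text \<open>\<open>C\<close> is the graph \<open>C(G)\<close>: it results from \<open>G\<close> by contracting monochromatic edges for as long as possible.\<close>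

definition bipartite_contraction ::
  "'a pair_pre_digraph \<Rightarrow> 'a set \<Rightarrow> 'a set pair_pre_digraph \<Rightarrow> bool" where
  "bipartite_contraction G B C \<longleftrightarrow>
     (contraction_step B)\<^sup>*\<^sup>* (singleton_graph G) C \<and> \<not> (\<exists>C'. contraction_step B C C')"

end

theory Submission
  imports Defs "Graph_Theory.Vertex_Walk"
begin

text \<open>
  Every finite forest can be ordered so that each vertex has at most one smaller neighbour. Let
  \<open>T\<close> be a nonempty set of uncoloured components and suppose that at least \<open>card T\<close> coloured vertices
  have two or more neighbours in \<open>\<Union>T\<close>. Each of them is the smaller neighbour of a vertex of \<open>\<Union>T\<close>,
  which is then the root of its component, and the smallest of all the vertices involved yields one
  further root; but every component has only one root. A matching of \<open>C(G)\<close> provides distinct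
  coloured vertices adjacent to the selected components, so that one of those whose component is
  returned by the oracle has exactly one uncoloured neighbour.
\<close>

section \<open>Elimination orderings of forests\<close>

lemma pcas_vwalk_arcs: "pcas x (vwalk_arcs (x # xs)) (last (x # xs))"
  by (induction xs arbitrary: x) auto

lemma pawalk_verts_vwalk_arcs: "pawalk_verts x (vwalk_arcs (x # xs)) = x # xs"
  by (induction xs arbitrary: x) auto

lemma set_vwalk_arcs_subset_iff:
  "set (vwalk_arcs xs) \<subseteq> E \<longleftrightarrow> successively (\<lambda>a b. (a, b) \<in> E) xs"
  by (induction xs rule: vwalk_arcs.induct) auto

lemma length_vwalk_arcs: "length (vwalk_arcs xs) = length xs - 1"
  by (induction xs rule: vwalk_arcs.induct) auto

text \<open>Take a longest path inside \<open>U\<close>, which exists because its distinct vertices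
  bound its length by \<open>card U\<close>. Its first vertex \<open>x\<close> has all its
  neighbours in \<open>U\<close> on the path, and one that is not the second vertex would close a
  cycle.\<close>

lemma (in pair_graph) forest_has_leaf:
  assumes acyclic: "\<not> (\<exists>p. cycle p \<and> length p \<ge> 3)"
    and U: "U \<subseteq> pverts G" "U \<noteq> {}"
  shows "\<exists>x\<in>U. \<forall>u\<in>U. \<forall>u'\<in>U. (x, u) \<in> parcs G \<longrightarrow> (x, u') \<in> parcs G \<longrightarrow> u = u'"
proof -
  let ?path = "\<lambda>xs. xs \<noteq> [] \<and> distinct xs \<and> set xs \<subseteq> U \<and>
    successively (\<lambda>a b. (a, b) \<in> parcs G) xs"
  have fin: "finite U"
    using U(1) pair_finite_verts by (rule finite_subset)
  have "length xs \<le> card U" if "?path xs" for xs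
    using that fin by (metis card_mono distinct_card)
  moreover obtain a where "a \<in> U" using U(2) by blast
  then have "?path [a]" by simp
  ultimately obtain xs where path: "?path xs"
    and longest: "\<And>ys. ?path ys \<Longrightarrow> length ys \<le> length xs"
    using ex_has_greatest_nat[of ?path "[a]" length "card U + 1"] by (metis le_imp_less_Suc Suc_eq_plus1)
  then obtain x r where xs: "xs = x # r" by (cases xs) auto
  have on_path: "u \<in> set r" if "u \<in> U" "(x, u) \<in> parcs G" for u
  proof (rule ccontr)
    assume "u \<notin> set r"
    moreover have "u \<noteq> x" using pair_no_loops[OF that(2)] by auto
    moreover have "(u, x) \<in> parcs G"
      using that(2) pair_sym_arcs by (auto simp: symmetric_def dest: symD)
    ultimately have "?path (u # xs)" using path xs that(1) by auto
    from longest[OF this] show False by simp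
  qed
  have first: "u = hd r" if u: "u \<in> U" "(x, u) \<in> parcs G" for u
  proof (rule ccontr)
    assume "u \<noteq> hd r"
    obtain r1 r2 where r: "r = r1 @ u # r2" using on_path[OF u] by (meson split_list)
    with \<open>u \<noteq> hd r\<close> have "r1 \<noteq> []" by auto
    \<comment> \<open>The walk follows the path from \<open>x\<close> through \<open>r1\<close> to
      \<open>u\<close> and returns along the edge between \<open>u\<close> and \<open>x\<close>. It
      has \<open>length r1 + 2\<close> arcs, so \<open>r1 \<noteq> []\<close> makes it one of the
      forbidden cycles rather than an edge walked back and forth.\<close>
    let ?c = "vwalk_arcs (x # r1 @ [u, x])"
    have "(u, x) \<in> parcs G"
      using u(2) pair_sym_arcs by (auto simp: symmetric_def dest: symD)
    then have "set ?c \<subseteq> parcs G"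
      using path unfolding set_vwalk_arcs_subset_iff xs r
      by (auto simp: successively_append_iff successively_Cons hd_append)
    moreover have "x \<in> pverts G" using path xs U(1) by auto
    moreover have "pcas x ?c x"
      using pcas_vwalk_arcs[of x "r1 @ [u, x]"] by simp
    ultimately have "awalk x ?c x" by (simp add: awalk_def)
    moreover have "pawalk_verts x ?c = x # r1 @ [u, x]"
      by (rule pawalk_verts_vwalk_arcs)
    then have "distinct (tl (pawalk_verts x ?c))"
      using path xs r by auto
    moreover have len: "length ?c \<ge> 3"
      using \<open>r1 \<noteq> []\<close> unfolding length_vwalk_arcs by (cases r1) auto
    then have "?c \<noteq> []" by auto
    ultimately have "cycle ?c" unfolding cycle_def by blast
    with len acyclic show False by blast
  qed
  have "x \<in> U" using path xs by auto
  with first show ?thesis by blast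
qed

text \<open>Leaves are stripped one at a time: the leaf \<open>x\<close> gets the largest value and
  the rest is ordered by induction. The values of \<open>h\<close> below \<open>h x\<close> then see
  at most one neighbour of \<open>x\<close>, and \<open>x\<close> is never a smaller neighbour of
  another vertex.\<close>

lemma elimination_ordering:
  assumes "finite V"
    and leaf: "\<And>U. U \<subseteq> V \<Longrightarrow> U \<noteq> {} \<Longrightarrow>
      \<exists>x\<in>U. \<forall>u\<in>U. \<forall>u'\<in>U. (x, u) \<in> E \<longrightarrow> (x, u') \<in> E \<longrightarrow> u = u'"
  obtains h :: "'a \<Rightarrow> nat" where "inj_on h V"
    "\<And>v u u'. \<lbrakk>v \<in> V; u \<in> V; u' \<in> V; (v, u) \<in> E; (v, u') \<in> E; h u < h v; h u' < h v\<rbrakk> \<Longrightarrow> u = u'"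
proof -
  \<comment> \<open>The bound \<open>h v < card U\<close> strengthens the induction, so that
    \<open>n = card (U - {x})\<close> is a new value above all those already used.\<close>
  have "\<exists>h :: 'a \<Rightarrow> nat. inj_on h U \<and> (\<forall>v\<in>U. h v < card U) \<and>
      (\<forall>v\<in>U. \<forall>u\<in>U. \<forall>u'\<in>U. (v, u) \<in> E \<longrightarrow> (v, u') \<in> E \<longrightarrow> h u < h v \<longrightarrow> h u' < h v \<longrightarrow> u = u')"
    if "U \<subseteq> V" for U
    using that
  proof (induction "card U" arbitrary: U)
    case 0
    then have "U = {}" using \<open>finite V\<close> by (metis card_0_eq finite_subset)
    then show ?case by simp
  next
    case (Suc n)
    then have fin: "finite U" and "U \<noteq> {}"
      using \<open>finite V\<close> by (auto intro: finite_subset)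
    then obtain x where x: "x \<in> U"
      "\<And>u u'. \<lbrakk>u \<in> U; u' \<in> U; (x, u) \<in> E; (x, u') \<in> E\<rbrakk> \<Longrightarrow> u = u'"
      using leaf[OF Suc.prems] by blast
    have n: "n = card (U - {x})" using Suc.hyps(2) x(1) fin by simp
    have sub: "U - {x} \<subseteq> V" using Suc.prems by blast
    obtain h :: "'a \<Rightarrow> nat" where IH: "inj_on h (U - {x}) \<and> (\<forall>v\<in>U - {x}. h v < card (U - {x})) \<and>
      (\<forall>v\<in>U - {x}. \<forall>u\<in>U - {x}. \<forall>u'\<in>U - {x}.
        (v, u) \<in> E \<longrightarrow> (v, u') \<in> E \<longrightarrow> h u < h v \<longrightarrow> h u' < h v \<longrightarrow> u = u')"
      using Suc.hyps(1)[OF n sub] by (elim exE)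
    then have h: "inj_on h (U - {x})" "\<And>v. v \<in> U - {x} \<Longrightarrow> h v < n"
      "\<And>v u u'. \<lbrakk>v \<in> U - {x}; u \<in> U - {x}; u' \<in> U - {x}; (v, u) \<in> E; (v, u') \<in> E;
         h u < h v; h u' < h v\<rbrakk> \<Longrightarrow> u = u'"
      unfolding n by blast+
    let ?h = "h(x := n)"
    have "inj_on ?h U"
      using h(1,2) by (fastforce simp: inj_on_def)
    moreover have "\<forall>v\<in>U. ?h v < card U"
      using h(2) Suc.hyps(2) by (metis Diff_iff fun_upd_apply lessI less_Suc_eq singletonD)
    moreover have "u = u'"
      if that: "v \<in> U" "u \<in> U" "u' \<in> U" "(v, u) \<in> E" "(v, u') \<in> E" "?h u < ?h v" "?h u' < ?h v"
      for v u u'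
    proof (cases "v = x")
      case True
      then show ?thesis using that x(2) by blast
    next
      case False
      then have v: "v \<in> U - {x}" using that(1) by blast
      moreover from this have "u \<noteq> x" "u' \<noteq> x"
        using that(6,7) h(2)[OF v] by auto
      ultimately show ?thesis using that h(3)[of v u u'] by simp
    qed
    ultimately show ?case by blast
  qed
  from this[OF order_refl] show thesis using that by blast
qed

section \<open>Counting roots of components\<close>

text \<open>A root is a vertex without smaller neighbours in \<open>W\<close>. Descending to the
  smaller neighbour within \<open>W\<close> is deterministic, and along any walk in \<open>W\<close>
  from the root \<open>s\<close> every vertex descends to \<open>s\<close>. Another root
  \<open>t\<close> on the walk cannot descend at all, hence \<open>t = s\<close>.\<close>

lemma root_unique:
  fixes h :: "'a \<Rightarrow> nat"
  assumes "sym E" "W \<subseteq> V" "inj_on h V"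
    and lower: "\<And>v u u'. \<lbrakk>v \<in> V; u \<in> V; u' \<in> V; (v, u) \<in> E; (v, u') \<in> E; h u < h v; h u' < h v\<rbrakk>
      \<Longrightarrow> u = u'"
    and reach: "(s, t) \<in> rtrancl_on W (E \<inter> W \<times> W)"
    and s: "\<And>u. u \<in> W \<Longrightarrow> (s, u) \<in> E \<Longrightarrow> \<not> h u < h s"
    and t: "\<And>u. u \<in> W \<Longrightarrow> (t, u) \<in> E \<Longrightarrow> \<not> h u < h t"
  shows "s = t"
proof -
  define P where "P = {(v, u). v \<in> W \<and> u \<in> W \<and> (v, u) \<in> E \<and> h u < h v}"
  have sv: "x' = y" if "(x, x') \<in> P" "(x, y) \<in> P" for x x' y
    using that lower[of x x' y] \<open>W \<subseteq> V\<close> by (auto simp: P_def)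
  have "(t, s) \<in> P\<^sup>*"
    using reach
  proof (induction rule: rtrancl_on_induct)
    case base
    show ?case by simp
  next
    case (step y z)
    consider "y = z" | "(z, y) \<in> P" | "(y, z) \<in> P"
      using step.hyps \<open>sym E\<close> \<open>W \<subseteq> V\<close> \<open>inj_on h V\<close>
      by (auto simp: P_def dest: symD inj_onD) (metis inj_onD linorder_neqE_nat subsetD symD)
    then show ?case
    proof cases
      case 1
      then show ?thesis using step.IH by simp
    next
      case 2
      then show ?thesis using step.IH by (rule converse_rtrancl_into_rtrancl)
    next
      \<comment> \<open>The walk goes down from \<open>y\<close> to \<open>z\<close>. As
        \<open>s\<close> is a root, \<open>y \<noteq> s\<close>, so the descent from
        \<open>y\<close> to \<open>s\<close> has a first step, and by single-valuedness that step
        leads to \<open>z\<close>.\<close>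
      case 3
      then have "y \<noteq> s" using s by (auto simp: P_def)
      then obtain y' where "(y, y') \<in> P" "(y', s) \<in> P\<^sup>*"
        using step.IH by (metis converse_rtranclE)
      then show ?thesis using sv[OF _ 3] by blast
    qed
  qed
  moreover have "(t, u) \<notin> P" for u using t by (auto simp: P_def)
  ultimately show ?thesis by (metis converse_rtranclE)
qed

text \<open>In the application \<open>W\<close> is the set of uncoloured vertices, \<open>T\<close>
  the oracle's answer and \<open>D\<close> the set of coloured ends of the matching edges that lead
  into \<open>T\<close>. The counting only yields at most one neighbour; the matching edge itself
  will supply one.\<close>

lemma vertex_with_one_neighbour:
  fixes h :: "'a \<Rightarrow> nat"
  assumes "sym E" "inj_on h V"
    and lower: "\<And>v u u'. \<lbrakk>v \<in> V; u \<in> V; u' \<in> V; (v, u) \<in> E; (v, u') \<in> E; h u < h v; h u' < h v\<rbrakk>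
      \<Longrightarrow> u = u'"
    and W: "W \<subseteq> V"
    and T: "finite T" "T \<noteq> {}" "\<And>Y. Y \<in> T \<Longrightarrow> Y \<subseteq> W"
      "\<And>Y u v. \<lbrakk>Y \<in> T; u \<in> Y; v \<in> Y\<rbrakk> \<Longrightarrow> (u, v) \<in> rtrancl_on W (E \<inter> W \<times> W)"
      "\<And>Y u v. \<lbrakk>Y \<in> T; u \<in> Y; v \<in> W; (u, v) \<in> E\<rbrakk> \<Longrightarrow> v \<in> Y"
    and D: "D \<subseteq> V - W" "card D \<ge> card T"
  shows "\<exists>b\<in>D. \<forall>u\<in>\<Union>T. \<forall>u'\<in>\<Union>T. (b, u) \<in> E \<longrightarrow> (b, u') \<in> E \<longrightarrow> u = u'"
proof (rule ccontr)
  assume "\<not> ?thesis"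
  then have two: "\<exists>u\<in>\<Union>T. \<exists>u'\<in>\<Union>T. (b, u) \<in> E \<and> (b, u') \<in> E \<and> u \<noteq> u'" if "b \<in> D" for b
    using that by blast
  have TW: "\<Union>T \<subseteq> W" using T(3) by blast
  have neq: "h b \<noteq> h u" if "b \<in> D" "u \<in> \<Union>T" for b u
    using that TW W D(1) \<open>inj_on h V\<close> unfolding inj_on_def by blast
  \<comment> \<open>\<open>R\<close> collects the roots lying in the members of \<open>T\<close>. By
    \<open>root_unique\<close> each member contains at most one, so
    \<open>card R \<le> card T\<close>.\<close>
  define R where "R = {t \<in> \<Union>T. \<forall>u\<in>W. (t, u) \<in> E \<longrightarrow> \<not> h u < h t}"
  have "\<forall>t\<in>R. \<exists>Y. Y \<in> T \<and> t \<in> Y" by (auto simp: R_def)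
  then obtain comp where comp: "\<And>t. t \<in> R \<Longrightarrow> comp t \<in> T \<and> t \<in> comp t"
    by metis
  have "inj_on comp R"
  proof (rule inj_onI)
    fix s t assume st: "s \<in> R" "t \<in> R" "comp s = comp t"
    then have reach: "(s, t) \<in> rtrancl_on W (E \<inter> W \<times> W)"
      using comp T(4) by metis
    show "s = t"
      by (rule root_unique[OF \<open>sym E\<close> W \<open>inj_on h V\<close> _ reach])
        (rule lower, assumption+, use st in \<open>auto simp: R_def\<close>)
  qed
  moreover have "comp ` R \<subseteq> T" using comp by blast
  ultimately have "card R \<le> card T" "finite R"
    using T(1) by (auto intro: card_inj_on_le inj_on_finite)
  \<comment> \<open>If \<open>b\<close> is smaller than \<open>u\<close>, it is the only smaller
    neighbour of \<open>u\<close>; since \<open>b\<close> lies outside \<open>W\<close>, none is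
    left inside \<open>W\<close>.\<close>
  have upper_root: "u \<in> R" if "b \<in> D" "u \<in> \<Union>T" "(b, u) \<in> E" "h b < h u" for b u
  proof -
    have "v = b" if "v \<in> W" "(u, v) \<in> E" "h v < h u" for v
      by (rule lower[of u]) (use that \<open>b \<in> D\<close> \<open>u \<in> \<Union>T\<close> \<open>(b, u) \<in> E\<close> \<open>h b < h u\<close> TW W D(1)
          \<open>sym E\<close> in \<open>auto dest: symD\<close>)
    then show ?thesis using that(1,2) D(1) by (auto simp: R_def)
  qed
  have lower_D: "b = b'"
    if "b \<in> D" "b' \<in> D" "u \<in> \<Union>T" "(b, u) \<in> E" "h b < h u" "(b', u) \<in> E" "h b' < h u" for b b' u
    by (rule lower[of u]) (use that TW W D(1) \<open>sym E\<close> in \<open>auto dest: symD\<close>)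
  \<comment> \<open>At most one of the two neighbours of \<open>b\<close> is smaller than
    \<open>b\<close>, so the other is larger. Choosing it as \<open>c b\<close> gives
    \<open>card D\<close> distinct roots.\<close>
  have "\<exists>u\<in>\<Union>T. (b, u) \<in> E \<and> h b < h u" if b: "b \<in> D" for b
  proof -
    obtain u u' where u: "u \<in> \<Union>T" "u' \<in> \<Union>T" "(b, u) \<in> E" "(b, u') \<in> E" "u \<noteq> u'"
      using two[OF b] by blast
    then have "\<not> (h u < h b \<and> h u' < h b)"
      using lower[of b u u'] b D(1) TW W by blast
    then show ?thesis using u neq[OF b] by (metis linorder_neqE_nat)
  qed
  then obtain c where c: "\<And>b. b \<in> D \<Longrightarrow> c b \<in> \<Union>T \<and> (b, c b) \<in> E \<and> h b < h (c b)"
    by metis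
  have "inj_on c D" by (rule inj_onI) (metis c lower_D)
  have "c ` D \<subseteq> R" using c upper_root by blast
  have "D \<noteq> {}"
    using D(2) T(1,2) by (auto simp: card_0_eq)
  then obtain m where m: "m \<in> \<Union>T \<union> D" "\<And>x. x \<in> \<Union>T \<union> D \<Longrightarrow> h m \<le> h x"
    using ex_has_least_nat[of "\<lambda>x. x \<in> \<Union>T \<union> D" _ h] by blast
  \<comment> \<open>The least vertex \<open>m\<close> yields one more root. If
    \<open>m \<in> D\<close>, both its neighbours lie above it and the one other than
    \<open>c m\<close> is a root, which no other vertex of \<open>D\<close> can claim by
    \<open>lower_D\<close>. Otherwise \<open>m\<close> is itself a root, and it is no
    \<open>c b\<close> because \<open>h b < h (c b)\<close>.\<close>
  have "\<exists>d. d \<in> R - c ` D"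
  proof (cases "m \<in> D")
    case True
    then obtain d where d: "d \<in> \<Union>T" "(m, d) \<in> E" "d \<noteq> c m"
      using two[OF True] by metis
    then have "h m < h d" using m(2)[of d] neq[OF True d(1)] by simp
    then have "d \<in> R" using upper_root[OF True d(1,2)] by blast
    moreover have "d \<notin> c ` D"
      using d c lower_D[OF True _ d(1,2) \<open>h m < h d\<close>] by auto
    ultimately show ?thesis by blast
  next
    case False
    then obtain Y where Y: "Y \<in> T" "m \<in> Y" using m(1) by blast
    have "\<not> h u < h m" if "u \<in> W" "(m, u) \<in> E" for u
      using T(5)[OF Y that] Y(1) m(2)[of u] by (auto simp: not_less)
    then have "m \<in> R" using Y by (auto simp: R_def)
    moreover have "m \<notin> c ` D"
      using c m(2) by (metis UnCI image_iff leD)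
    ultimately show ?thesis by blast
  qed
  with \<open>c ` D \<subseteq> R\<close> have "c ` D \<subset> R" by blast
  then have "card (c ` D) < card R"
    using \<open>finite R\<close> by (rule psubset_card_mono[rotated])
  then show False
    using \<open>card R \<le> card T\<close> D(2) card_image[OF \<open>inj_on c D\<close>] by simp
qed

section \<open>The bipartite contraction\<close>

lemma arcs_ends_induce_with_proj:
  "arcs_ends (with_proj G \<restriction> S) = parcs G \<inter> S \<times> S"
  by (auto simp: arcs_ends_def arc_to_ends_def image_iff)

lemma reachable_induce_with_proj:
  "u \<rightarrow>\<^sup>*\<^bsub>with_proj G \<restriction> S\<^esub> v \<longleftrightarrow> (u, v) \<in> rtrancl_on S (parcs G \<inter> S \<times> S)"
  unfolding reachable_def arcs_ends_induce_with_proj by simp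

text \<open>The invariant of the contraction process: \<open>H\<close> is a quotient of
  \<open>G\<close> by monochromatic classes. Connectivity of an uncoloured class is measured in the
  whole uncoloured subgraph, which is the form that membership in \<open>components\<close> asks
  for.\<close>

definition contracted :: "'a pair_pre_digraph \<Rightarrow> 'a set \<Rightarrow> 'a set pair_pre_digraph \<Rightarrow> bool" where
  "contracted G B H \<longleftrightarrow> partition_on (pverts G) (pverts H) \<and>
     (\<forall>X\<in>pverts H. X \<subseteq> B \<or> X \<inter> B = {} \<and>
        (\<forall>u\<in>X. \<forall>v\<in>X. u \<rightarrow>\<^sup>*\<^bsub>with_proj G \<restriction> (pverts G - B)\<^esub> v)) \<and>
     parcs H = {(U, V). U \<in> pverts H \<and> V \<in> pverts H \<and> U \<noteq> V \<and> (\<exists>u\<in>U. \<exists>v\<in>V. (u, v) \<in> parcs G)}"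

lemma (in pair_graph) contracted_singleton_graph: "contracted G B (singleton_graph G)"
proof -
  have "u \<noteq> v" if "(u, v) \<in> parcs G" for u v using pair_no_loops[OF that] by simp
  then have "parcs (singleton_graph G) = {(U, V). U \<in> pverts (singleton_graph G) \<and>
      V \<in> pverts (singleton_graph G) \<and> U \<noteq> V \<and> (\<exists>u\<in>U. \<exists>v\<in>V. (u, v) \<in> parcs G)}"
    by (auto simp: singleton_graph_def image_iff dest: in_arcsD1 in_arcsD2)
  moreover have "partition_on (pverts G) (pverts (singleton_graph G))"
    by (auto simp: singleton_graph_def partition_on_def disjoint_def)
  ultimately show ?thesis
    unfolding contracted_def reachable_induce_with_proj
    by (auto simp: singleton_graph_def)
qed

text \<open>The assumption \<open>good\<close> is the invariant for the merged class alone, so both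
  colours share one argument; all other classes are unchanged.\<close>

lemma contracted_contract_edge:
  assumes H: "contracted G B H" and XY: "(X, Y) \<in> parcs H"
    and good: "X \<union> Y \<subseteq> B \<or> (X \<union> Y) \<inter> B = {} \<and>
      (\<forall>u\<in>X \<union> Y. \<forall>v\<in>X \<union> Y. u \<rightarrow>\<^sup>*\<^bsub>with_proj G \<restriction> (pverts G - B)\<^esub> v)"
  shows "contracted G B (contract_edge H X Y)"
proof -
  let ?P = "pverts H" and ?P' = "pverts (contract_edge H X Y)"
  have part: "partition_on (pverts G) ?P" and mono: "\<forall>Z\<in>?P. Z \<subseteq> B \<or> Z \<inter> B = {} \<and>
        (\<forall>u\<in>Z. \<forall>v\<in>Z. u \<rightarrow>\<^sup>*\<^bsub>with_proj G \<restriction> (pverts G - B)\<^esub> v)"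
    and arcs: "parcs H = {(U, V). U \<in> ?P \<and> V \<in> ?P \<and> U \<noteq> V \<and> (\<exists>u\<in>U. \<exists>v\<in>V. (u, v) \<in> parcs G)}"
    using H by (auto simp: contracted_def)
  have XYP: "X \<in> ?P" "Y \<in> ?P" using XY arcs by auto
  have P': "?P' = insert (X \<union> Y) (?P - {X, Y})"
    using XYP by (auto simp: contract_edge_def merge_def)
  have "partition_on (pverts G) ?P'"
  proof (rule partition_onI)
    show "\<Union>?P' = pverts G"
      using part XYP unfolding P' partition_on_def by blast
    show "{} \<notin> ?P'"
      using part XYP unfolding P' partition_on_def by auto
    have disj: "p \<inter> p' = {}" if "p \<in> ?P" "p' \<in> ?P" "p \<noteq> p'" for p p'
      using part that by (auto simp: partition_on_def dest: disjointD)
    have disj': "p \<inter> (X \<union> Y) = {}" if "p \<in> ?P - {X, Y}" for p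
      using disj[of p X] disj[of p Y] that XYP by (simp add: Int_Un_distrib)
    show "disjnt p p'" if p: "p \<in> ?P'" "p' \<in> ?P'" "p \<noteq> p'" for p p'
    proof -
      consider "p = X \<union> Y" "p' \<in> ?P - {X, Y}" | "p' = X \<union> Y" "p \<in> ?P - {X, Y}" |
        "p \<in> ?P" "p' \<in> ?P"
        using p unfolding P' by blast
      then show ?thesis
        using disj'[of p] disj'[of p'] disj[of p p'] p(3) by cases (auto simp: disjnt_def)
    qed
  qed
  moreover have "\<forall>Z\<in>?P'. Z \<subseteq> B \<or> Z \<inter> B = {} \<and>
        (\<forall>u\<in>Z. \<forall>v\<in>Z. u \<rightarrow>\<^sup>*\<^bsub>with_proj G \<restriction> (pverts G - B)\<^esub> v)"
  proof
    fix Z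
    assume "Z \<in> ?P'"
    then have "Z = X \<union> Y \<or> Z \<in> ?P" unfolding P' by blast
    then show "Z \<subseteq> B \<or> Z \<inter> B = {} \<and>
        (\<forall>u\<in>Z. \<forall>v\<in>Z. u \<rightarrow>\<^sup>*\<^bsub>with_proj G \<restriction> (pverts G - B)\<^esub> v)"
      using good bspec[OF mono, of Z] by (elim disjE[of "Z = X \<union> Y"]) simp_all
  qed
  moreover have eq: "(U', V') \<in> parcs (contract_edge H X Y) \<longleftrightarrow>
      U' \<in> ?P' \<and> V' \<in> ?P' \<and> U' \<noteq> V' \<and> (\<exists>u\<in>U'. \<exists>v\<in>V'. (u, v) \<in> parcs G)" (is "?L \<longleftrightarrow> ?R") for U' V'
  proof
    assume ?L
    then obtain U V where UV: "(U, V) \<in> parcs H" "U' = merge X Y U" "V' = merge X Y V" "U' \<noteq> V'"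
      by (auto simp: contract_edge_def)
    from UV(1) obtain u v where "U \<in> ?P" "V \<in> ?P" "u \<in> U" "v \<in> V" "(u, v) \<in> parcs G"
      unfolding arcs by blast
    moreover have "Z \<subseteq> merge X Y Z" for Z by (auto simp: merge_def)
    moreover have "?P' = merge X Y ` ?P" by (simp add: contract_edge_def)
    ultimately show ?R using UV(2-4) by blast
  next
    assume R: ?R
    \<comment> \<open>Every element of a new class lies in an old class that is merged into it. An
      arc of \<open>G\<close> between two new classes therefore comes from an arc of
      \<open>H\<close>.\<close>
    have lift: "\<exists>U\<in>?P. z \<in> U \<and> merge X Y U = Z" if "z \<in> Z" "Z \<in> ?P'" for z Z
      using that XYP unfolding P' by (auto simp: merge_def)
    from R obtain u v where uv: "u \<in> U'" "v \<in> V'" "(u, v) \<in> parcs G" by blast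
    obtain U V where UV: "U \<in> ?P" "u \<in> U" "merge X Y U = U'" "V \<in> ?P" "v \<in> V" "merge X Y V = V'"
      using lift[OF uv(1)] lift[OF uv(2)] R by blast
    then have "(U, V) \<in> parcs H" unfolding arcs using uv(3) R by blast
    then show ?L using UV(3,6) R by (simp add: contract_edge_def) blast
  qed
  moreover have "parcs (contract_edge H X Y) =
      {(U, V). U \<in> ?P' \<and> V \<in> ?P' \<and> U \<noteq> V \<and> (\<exists>u\<in>U. \<exists>v\<in>V. (u, v) \<in> parcs G)}"
    using eq by (simp add: set_eq_iff split_paired_all)
  ultimately show ?thesis unfolding contracted_def by (intro conjI)
qed

lemma (in pair_graph) contracted_step:
  assumes "contraction_step B H H'" "contracted G B H"
  shows "contracted G B H'"
  using assms(1)
proof cases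
  case (coloured X Y)
  then show ?thesis using contracted_contract_edge[OF assms(2) coloured(2)] by simp
next
  case (uncoloured X Y)
  let ?W = "pverts G - B"
  let ?r = "\<lambda>u v. u \<rightarrow>\<^sup>*\<^bsub>with_proj G \<restriction> ?W\<^esub> v"
  interpret I: wf_digraph "with_proj G \<restriction> ?W" by (rule wellformed_induce_subgraph)
  have XY: "X \<in> pverts H" "Y \<in> pverts H" "\<exists>x\<in>X. \<exists>y\<in>Y. (x, y) \<in> parcs G"
    using uncoloured(2) assms(2) by (auto simp: contracted_def)
  then obtain x y where xy: "x \<in> X" "y \<in> Y" "(x, y) \<in> parcs G" by blast
  have conn: "?r u v" if "Z \<in> pverts H" "Z \<inter> B = {}" "u \<in> Z" "v \<in> Z" for Z u v
  proof -
    have "Z \<subseteq> B \<or> Z \<inter> B = {} \<and> (\<forall>u\<in>Z. \<forall>v\<in>Z. ?r u v)"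
      using assms(2) that(1) by (simp add: contracted_def)
    with that(2-) show ?thesis by blast
  qed
  \<comment> \<open>The edge between \<open>x\<close> and \<open>y\<close> is usable in both
    directions inside the uncoloured subgraph and so links the connected classes \<open>X\<close>
    and \<open>Y\<close>.\<close>
  have "(y, x) \<in> parcs G"
    using xy(3) pair_sym_arcs by (auto simp: symmetric_def dest: symD)
  then have "?r x y" "?r y x"
    using xy uncoloured(3,4) in_arcsD1 in_arcsD2
    by (auto intro!: I.reachable_adjI simp: arcs_ends_induce_with_proj)
  then have "\<forall>u\<in>X \<union> Y. \<forall>v\<in>X \<union> Y. ?r u v"
    using xy(1,2) conn[OF XY(1) uncoloured(3)] conn[OF XY(2) uncoloured(4)]
    by (metis I.reachable_trans Un_iff)
  then show ?thesis
    using contracted_contract_edge[OF assms(2) uncoloured(2)] uncoloured by blast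
qed

lemma (in pair_graph) contracted_bipartite_contraction:
  assumes "bipartite_contraction G B C"
  shows "contracted G B C"
proof -
  have "(contraction_step B)\<^sup>*\<^sup>* (singleton_graph G) C"
    using assms by (simp add: bipartite_contraction_def)
  then show ?thesis
    by induction (auto intro: contracted_singleton_graph contracted_step)
qed

section \<open>Components of the uncoloured subgraph as vertices of the contraction\<close>

lemma componentsD:
  assumes "Y \<in> components G S"
  shows "Y \<subseteq> S" "\<And>u v. \<lbrakk>u \<in> Y; v \<in> Y\<rbrakk> \<Longrightarrow> (u, v) \<in> rtrancl_on S (parcs G \<inter> S \<times> S)"
  using assms unfolding components_def pre_digraph.sccs_verts_def reachable_induce_with_proj
  by (auto dest: in_rtrancl_on_in_F)

text \<open>By symmetry the arc makes \<open>u\<close> and \<open>v\<close> mutually reachable,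
  which contradicts the maximality of a strongly connected component.\<close>

lemma components_closed:
  assumes "Y \<in> components G S" "sym (parcs G)" "u \<in> Y" "v \<in> S" "(u, v) \<in> parcs G"
  shows "v \<in> Y"
proof (rule ccontr)
  assume "v \<notin> Y"
  have "u \<in> S" using componentsD(1)[OF assms(1)] assms(3) by blast
  then have "(u, v) \<in> rtrancl_on S (parcs G \<inter> S \<times> S)" "(v, u) \<in> rtrancl_on S (parcs G \<inter> S \<times> S)"
    using assms(2,4,5) by (auto intro: rtrancl_on_into_rtrancl_on dest: symD)
  then show False
    using assms(1,3) \<open>v \<notin> Y\<close>
    unfolding components_def pre_digraph.sccs_verts_def reachable_induce_with_proj by blast
qed

text \<open>Connectivity comes from the invariant and maximality from termination: an edge from
  \<open>Y\<close> to an uncoloured vertex outside \<open>Y\<close> would still be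
  contractible.\<close>

lemma (in pair_graph) uncoloured_vertex_is_component:
  assumes C: "bipartite_contraction G B C" and Y: "Y \<in> pverts C" "\<not> Y \<subseteq> B"
  shows "Y \<in> components G (pverts G - B)"
proof -
  let ?W = "pverts G - B"
  have cC: "contracted G B C" by (rule contracted_bipartite_contraction[OF C])
  have part: "partition_on (pverts G) (pverts C)" using cC by (simp add: contracted_def)
  have YB: "Y \<inter> B = {}" and conn: "\<forall>u\<in>Y. \<forall>v\<in>Y. u \<rightarrow>\<^sup>*\<^bsub>with_proj G \<restriction> ?W\<^esub> v"
    using cC Y by (auto simp: contracted_def)
  have closed: "z \<in> Y" if yz: "y \<in> Y" "z \<in> ?W" "(y, z) \<in> parcs G" for y z
  proof (rule ccontr)
    assume "z \<notin> Y"
    obtain Z where Z: "Z \<in> pverts C" "z \<in> Z"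
      using part yz(2) by (auto simp: partition_on_def)
    then have "Z \<inter> B = {}" using cC yz(2) by (auto simp: contracted_def)
    moreover have "(Y, Z) \<in> parcs C"
      using cC Y(1) Z \<open>z \<notin> Y\<close> yz by (auto simp: contracted_def)
    ultimately have "contraction_step B C (contract_edge C Y Z)"
      using YB by (intro contraction_step.uncoloured)
    then show False using C by (auto simp: bipartite_contraction_def)
  qed
  have "v \<in> Y" if "(u, v) \<in> rtrancl_on ?W (parcs G \<inter> ?W \<times> ?W)" "u \<in> Y" for u v
    using that by induction (use closed in auto)
  moreover have "Y \<noteq> {}" using Y(2) by auto
  ultimately show ?thesis
    using conn unfolding components_def pre_digraph.sccs_verts_def reachable_induce_with_proj
    by blast
qed

text \<open>No monochromatic arc survives termination, so each arc can be oriented from its coloured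
  end \<open>X\<close> to its uncoloured end \<open>Y\<close> and traced back to an arc of
  \<open>G\<close>.\<close>

lemma (in pair_graph) contraction_arcE:
  assumes C: "bipartite_contraction G B C" and "(U, V) \<in> parcs C"
  obtains X Y b w where "{U, V} = {X, Y}" "X \<in> pverts C" "X \<subseteq> B"
    "Y \<in> components G (pverts G - B)" "b \<in> X" "w \<in> Y" "(b, w) \<in> parcs G"
proof -
  have cC: "contracted G B C" by (rule contracted_bipartite_contraction[OF C])
  then have UV: "U \<in> pverts C" "V \<in> pverts C" using assms(2) by (auto simp: contracted_def)
  obtain u v where uv: "u \<in> U" "v \<in> V" "(u, v) \<in> parcs G"
    using cC assms(2) by (auto simp: contracted_def)
  have vu: "(v, u) \<in> parcs G"
    using uv(3) pair_sym_arcs by (auto simp: symmetric_def dest: symD)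
  have final: "\<not> contraction_step B C C'" for C'
    using C by (auto simp: bipartite_contraction_def)
  have "\<not> (U \<subseteq> B \<and> V \<subseteq> B)"
    using final assms(2) contraction_step.coloured by blast
  moreover have "\<not> (U \<inter> B = {} \<and> V \<inter> B = {})"
    using final assms(2) contraction_step.uncoloured by blast
  ultimately consider "U \<subseteq> B" "\<not> V \<subseteq> B" | "V \<subseteq> B" "\<not> U \<subseteq> B"
    using cC UV by (auto simp: contracted_def)
  then show thesis
  proof cases
    case 1
    then show thesis
      using that[of U V u v] UV uv uncoloured_vertex_is_component[OF C] by blast
  next
    case 2
    then show thesis
      using that[of V U v u] UV uv vu uncoloured_vertex_is_component[OF C] by blast
  qed
qed

section \<open>The move that selects the components met by the matching\<close>

theorem theorem2p2:
  fixes q :: nat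
    and G :: "'a pair_pre_digraph"
    and B :: "'a set"
    and C :: "'a set pair_pre_digraph"
  assumes "undirected_tree G"
    and "B \<subseteq> pverts G"
    and "bipartite_contraction G B C"
    and "\<exists>M. matching C M \<and> card M = q + 1"
  shows "\<exists>S. ccr_move q G B S \<and> permits_force G B S"
proof -
  let ?W = "pverts G - B"
  interpret pair_graph G using assms(1) by (simp add: undirected_tree_def)
  have symG: "sym (parcs G)" using pair_sym_arcs by (simp add: symmetric_def)
  have leaf: "\<exists>x\<in>U. \<forall>u\<in>U. \<forall>u'\<in>U. (x, u) \<in> parcs G \<longrightarrow> (x, u') \<in> parcs G \<longrightarrow> u = u'"
    if "U \<subseteq> pverts G" "U \<noteq> {}" for U
    by (rule forest_has_leaf[OF _ that]) (use assms(1) in \<open>simp add: undirected_tree_def\<close>)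
  obtain h :: "'a \<Rightarrow> nat" where h: "inj_on h (pverts G)"
    "\<And>v u u'. \<lbrakk>v \<in> pverts G; u \<in> pverts G; u' \<in> pverts G; (v, u) \<in> parcs G; (v, u') \<in> parcs G;
       h u < h v; h u' < h v\<rbrakk> \<Longrightarrow> u = u'"
    using elimination_ordering[OF pair_finite_verts leaf] by blast
  obtain M where M: "M \<subseteq> {{u, v} | u v. (u, v) \<in> parcs C}" "disjoint M" "card M = q + 1"
    using assms(4) by (auto simp: matching_def)
  have "\<forall>e\<in>M. \<exists>X Y b w. e = {X, Y} \<and> X \<in> pverts C \<and> X \<subseteq> B \<and>
      Y \<in> components G ?W \<and> b \<in> X \<and> w \<in> Y \<and> (b, w) \<in> parcs G"
  proof
    fix e
    assume "e \<in> M"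
    then obtain U V where UV: "e = {U, V}" "(U, V) \<in> parcs C" using M(1) by blast
    show "\<exists>X Y b w. e = {X, Y} \<and> X \<in> pverts C \<and> X \<subseteq> B \<and>
      Y \<in> components G ?W \<and> b \<in> X \<and> w \<in> Y \<and> (b, w) \<in> parcs G"
      by (rule contraction_arcE[OF assms(3) UV(2)]) (unfold UV(1), blast)
  qed
  then obtain X Y b w where "\<forall>e\<in>M. e = {X e, Y e} \<and> X e \<in> pverts C \<and> X e \<subseteq> B \<and>
      Y e \<in> components G ?W \<and> b e \<in> X e \<and> w e \<in> Y e \<and> (b e, w e) \<in> parcs G"
    unfolding bchoice_iff by (elim exE)
  then have e: "e = {X e, Y e}" "X e \<in> pverts C" "X e \<subseteq> B" "Y e \<in> components G ?W"
    "b e \<in> X e" "w e \<in> Y e" "(b e, w e) \<in> parcs G" if "e \<in> M" for e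
    using that by blast+
  have share: "e = f" if "e \<in> M" "f \<in> M" "Z \<in> e" "Z \<in> f" for e f Z
    using M(2) that by (auto dest: disjointD)
  have "inj_on Y M"
    using share e(1) by (intro inj_onI) (metis insertCI)
  have disjC: "disjoint (pverts C)"
    using contracted_bipartite_contraction[OF assms(3)] by (simp add: contracted_def partition_on_def)
  \<comment> \<open>Coloured classes of \<open>C\<close> are disjoint, so a common vertex
    \<open>b e' = b f\<close> forces the two matching edges to share their coloured end.\<close>
  have "inj_on b M"
  proof (rule inj_onI)
    fix e' f assume ef: "e' \<in> M" "f \<in> M" "b e' = b f"
    then have "X e' = X f"
      using disjointD[OF disjC e(2)[OF ef(1)] e(2)[OF ef(2)]] e(5)[OF ef(1)] e(5)[OF ef(2)] by auto
    then show "e' = f" using share[OF ef(1,2)] e(1) ef(1,2) by (metis insertCI)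
  qed
  have "ccr_move q G B (Y ` M)"
    using e(4) M(3) card_image[OF \<open>inj_on Y M\<close>] by (auto simp: ccr_move_def)
  moreover have "\<exists>b w. ccr_forces (with_proj G \<restriction> (B \<union> \<Union>T)) B b w"
    if T: "T \<subseteq> Y ` M" "T \<noteq> {}" for T
  proof -
    \<comment> \<open>\<open>I\<close> consists of the matching edges whose component was returned.
      Injectivity of \<open>Y\<close> and \<open>b\<close> on \<open>M\<close> gives as many
      coloured ends as returned components.\<close>
    define I where "I = {e \<in> M. Y e \<in> T}"
    have "T = Y ` I" using T(1) by (auto simp: I_def)
    have "I \<subseteq> M" by (auto simp: I_def)
    \<comment> \<open>An infinite set has cardinality 0, whereas
      \<open>card M = q + 1\<close>.\<close>
    have "finite M" using M(3) by (simp add: card_ge_0_finite)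
    then have finT: "finite T" using T(1) by (meson finite_imageI finite_subset)
    have TW: "Z \<in> components G ?W" if "Z \<in> T" for Z using that T(1) e(4) by auto
    have "card (b ` I) = card I" "card T = card I"
      unfolding \<open>T = Y ` I\<close>
      using \<open>I \<subseteq> M\<close> \<open>inj_on b M\<close> \<open>inj_on Y M\<close> by (auto intro!: card_image intro: inj_on_subset)
    then have "card T \<le> card (b ` I)" by simp
    moreover have "b ` I \<subseteq> B" using e(3,5) \<open>I \<subseteq> M\<close> by blast
    then have "b ` I \<subseteq> pverts G - ?W" using assms(2) by blast
    ultimately have D: "b ` I \<subseteq> pverts G - ?W" "card T \<le> card (b ` I)" by blast+
    have "\<exists>d\<in>b ` I. \<forall>u\<in>\<Union>T. \<forall>u'\<in>\<Union>T.
        (d, u) \<in> parcs G \<longrightarrow> (d, u') \<in> parcs G \<longrightarrow> u = u'"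
    proof (rule vertex_with_one_neighbour[OF symG h(1) _ _ finT T(2) _ _ _ D])
      show "u = u'" if "v \<in> pverts G" "u \<in> pverts G" "u' \<in> pverts G" "(v, u) \<in> parcs G"
        "(v, u') \<in> parcs G" "h u < h v" "h u' < h v" for v u u'
        using that by (rule h(2))
    qed (use componentsD[OF TW] components_closed[OF TW symG] in blast)+
    then obtain f where f: "f \<in> I"
      "\<And>u u'. \<lbrakk>u \<in> \<Union>T; u' \<in> \<Union>T; (b f, u) \<in> parcs G; (b f, u') \<in> parcs G\<rbrakk> \<Longrightarrow> u = u'"
      by blast
    have fM: "f \<in> M" and "w f \<in> \<Union>T" using f(1) e(6) by (auto simp: I_def)
    moreover have "b f \<in> B" using \<open>b ` I \<subseteq> B\<close> f(1) by blast
    moreover have "\<Union>T \<subseteq> ?W" using componentsD(1)[OF TW] by blast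
    \<comment> \<open>The uncoloured vertices of the induced subgraph are those of
      \<open>\<Union>T\<close>. Among them \<open>b f\<close> has at most one neighbour, and
      \<open>w f\<close> is one.\<close>
    ultimately have "ccr_forces (with_proj G \<restriction> (B \<union> \<Union>T)) B (b f) (w f)"
      using f(2) e(7)[OF fM] unfolding ccr_forces_def arcs_ends_induce_with_proj by auto
    then show ?thesis by blast
  qed
  ultimately show ?thesis unfolding permits_force_def by blast
qed

end
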